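(* Let $k \geq 3$ and $n \geq 2$ be integers, let $\alpha_k$ be a positive real number such that $$(k-1)^{\alpha_k} > e(2\alpha_k + 1),$$ and let $r$ be an integer with $r > \alpha_k n$. Then the number of vertices at graph distance $\leq r$ from a fixed vertex is larger in the (infinite) $k$-regular tree than in the $n$-dimensional grid.
   Context: The $n$-dimensional grid is the graph with vertex set $\mathbb{Z}^n$ in which two points are adjacent if and only if their Euclidean distance is $1$. Here $e$ is the base of the natural logarithm. *)

theory Defs
  imports "HOL-Analysis.Finite_Cartesian_Product" "Graph_Theory.Graph_Theory"
begin

text \<open>
  A possibly infinite simple graph is a symmetric, loop-free digraph whose arcs are pairs of
  vertices, i.e. a \<^locale>\<open>pair_bidirected_digraph\<close>; each edge is a pair of opposite arcs.

  The predicates \<^const>\<open>forest\<close> and \<^const>\<open>tree\<close> of the library cannot be used here: in a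
  symmetric digraph, going along an edge and back is a \<^const>\<open>pre_digraph.cycle\<close> of length two.
  The cycles of the undirected graph are those of length at least three.
\<close>

definition undirected_tree :: "'a pair_pre_digraph \<Rightarrow> bool" where
  "undirected_tree G \<longleftrightarrow>
     pair_bidirected_digraph G \<and> Digraph_Component.connected (with_proj G) \<and>
     \<not> (\<exists>p. pre_digraph.cycle (with_proj G) p \<and> length p \<ge> 3)"

definition regular_graph :: "nat \<Rightarrow> 'a pair_pre_digraph \<Rightarrow> bool" where
  "regular_graph k G \<longleftrightarrow>
     (\<forall>v \<in> pverts G. finite (out_arcs (with_proj G) v) \<and> out_degree (with_proj G) v = k)"

text \<open>The distance is infinite if the two vertices are not joined by a walk.\<close>

definition graph_dist :: "'a pair_pre_digraph \<Rightarrow> 'a \<Rightarrow> 'a \<Rightarrow> ereal" where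
  "graph_dist G u v = wf_digraph.\<mu> (with_proj G) (\<lambda>_. 1) u v"

definition graph_ball :: "'a pair_pre_digraph \<Rightarrow> 'a \<Rightarrow> int \<Rightarrow> 'a set" where
  "graph_ball G u r = {v \<in> pverts G. graph_dist G u v \<le> ereal (real_of_int r)}"

definition real_vec :: "int ^ 'n \<Rightarrow> real ^ 'n" where
  "real_vec x = (\<chi> i. real_of_int (x $ i))"

definition grid :: "(int ^ 'n) pair_pre_digraph" where
  "grid = \<lparr>pverts = UNIV, parcs = {(x, y). dist (real_vec x) (real_vec y) = 1}\<rparr>"

lemma pair_bidirected_digraph_grid: "pair_bidirected_digraph (grid :: (int ^ 'n) pair_pre_digraph)"
proof
  have "sym {(x, y). dist (real_vec x) (real_vec y) = 1}"
    by (rule symI) (simp add: dist_commute)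
  then show "symmetric (with_proj (grid :: (int ^ 'n) pair_pre_digraph))"
    by (simp add: symmetric_def grid_def arcs_ends_conv)
qed (auto simp: grid_def)

lemma finite_grid_neighbours: "finite {y. dist (real_vec x) (real_vec y) = 1}" for x :: "int ^ 'n"
proof -
  have "{y. dist (real_vec x) (real_vec y) = 1} \<subseteq> vec_lambda ` (\<Pi>\<^sub>E i\<in>UNIV. {x $ i - 1 .. x $ i + 1})"
  proof
    fix y assume "y \<in> {y. dist (real_vec x) (real_vec y) = 1}"
    then have "dist (real_vec x $ i) (real_vec y $ i) \<le> 1" for i
      using dist_vec_nth_le[of "real_vec x" i "real_vec y"] by simp
    then have "real_of_int \<bar>x $ i - y $ i\<bar> \<le> real_of_int 1" for i
      by (simp add: real_vec_def dist_real_def)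
    then have "\<bar>x $ i - y $ i\<bar> \<le> 1" for i
      unfolding of_int_le_iff .
    then have "x $ i - 1 \<le> y $ i \<and> y $ i \<le> x $ i + 1" for i
      unfolding abs_le_iff by (metis add.commute diff_le_eq minus_diff_eq)
    then have "vec_nth y \<in> (\<Pi>\<^sub>E i\<in>UNIV. {x $ i - 1 .. x $ i + 1})"
      by (simp add: PiE_UNIV_domain)
    then show "y \<in> vec_lambda ` (\<Pi>\<^sub>E i\<in>UNIV. {x $ i - 1 .. x $ i + 1})"
      by (rule rev_image_eqI) (simp add: vec_nth_inverse)
  qed
  then show ?thesis
    by (rule finite_subset) (intro finite_imageI finite_PiE; simp)
qed

text \<open>The cardinality of a ball in the grid is thus not the default value of an infinite set.\<close>

lemma finite_graph_ball_grid: "finite (graph_ball (grid :: (int ^ 'n) pair_pre_digraph) x r)"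
proof -
  interpret pair_bidirected_digraph "grid :: (int ^ 'n) pair_pre_digraph"
    by (rule pair_bidirected_digraph_grid)
  have cost: "awalk_cost (\<lambda>_. 1) p = real (length p)" for p :: "((int ^ 'n) \<times> (int ^ 'n)) list"
    by (induction p) auto
  have fin: "finite {v. \<exists>p. awalk x p v \<and> length p = m}" for m and x :: "int ^ 'n"
  proof (induction m arbitrary: x)
    case 0
    have "{v. \<exists>p. awalk x p v \<and> length p = 0} \<subseteq> {x}"
      by (auto simp: awalk_Nil_iff)
    then show ?case by (rule finite_subset) simp
  next
    case (Suc m)
    have "{v. \<exists>p. awalk x p v \<and> length p = Suc m} \<subseteq>
        (\<Union>y\<in>{y. dist (real_vec x) (real_vec y) = 1}. {v. \<exists>p. awalk y p v \<and> length p = m})"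
    proof
      fix v assume "v \<in> {v. \<exists>p. awalk x p v \<and> length p = Suc m}"
      then obtain e p where "awalk x (e # p) v" "length p = m"
        by (auto simp: length_Suc_conv)
      then show "v \<in> (\<Union>y\<in>{y. dist (real_vec x) (real_vec y) = 1}. {v. \<exists>p. awalk y p v \<and> length p = m})"
        unfolding awalk_Cons_iff by (intro UN_I[of "snd e"]) (auto simp: grid_def)
    qed
    then show ?case
      by (rule finite_subset) (intro finite_UN_I finite_grid_neighbours Suc)
  qed
  have "graph_ball grid x r \<subseteq> (\<Union>m\<le>nat (r + 1). {v. \<exists>p. awalk x p v \<and> length p = m})"
  proof
    fix v assume "v \<in> graph_ball grid x r"
    then have "\<mu> (\<lambda>_. 1) x v \<le> ereal (real_of_int r)"
      by (simp add: graph_ball_def graph_dist_def)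
    then have "\<mu> (\<lambda>_. 1) x v < ereal (real_of_int (r + 1))"
      by (rule le_less_trans) simp
    then obtain p where p: "awalk x p v" "real (length p) < real_of_int (r + 1)"
      unfolding \<mu>_def by (auto simp: INF_less_iff cost)
    then have "length p \<le> nat (r + 1)" by linarith
    with p show "v \<in> (\<Union>m\<le>nat (r + 1). {v. \<exists>p. awalk x p v \<and> length p = m})" by blast
  qed
  then show ?thesis
    by (rule finite_subset) (intro finite_UN_I fin; simp)
qed

end

theory Submission
  imports Defs
begin

text \<open>
  In the tree, two neighbours of \<open>v\<close> that are no further from \<open>t\<close> than \<open>v\<close> would be joined by a walk
  avoiding \<open>v\<close>, hence close a cycle; so each sphere is at least \<open>k - 1\<close> times as large as the previous
  one and the ball has at least \<open>(k - 1)\<^sup>r\<close> points. In the grid the ball is an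
  \<open>\<ell>\<^sub>1\<close>-ball, and giving the point \<open>y\<close> the weight \<open>z\<close> to the power \<open>\<parallel>y - x\<parallel>\<^sub>1\<close> bounds its size by
  \<open>((1 + z) / (1 - z))\<^sup>n / z\<^sup>r\<close> for every \<open>0 < z < 1\<close>. The choice \<open>z = exp (-1/\<alpha>)\<close> makes this at most
  \<open>(2\<alpha> + 1)\<^sup>n exp (r/\<alpha>)\<close>, which is at most \<open>(e (2\<alpha> + 1))\<close> to the power \<open>r/\<alpha>\<close> because \<open>n < r/\<alpha>\<close>.
\<close>

section \<open>Walks and balls\<close>

lemma (in pair_wf_digraph) graph_ball_eq_walks:
  assumes "r \<ge> 0"
  shows "graph_ball G u r = {v. \<exists>p. awalk u p v \<and> length p \<le> nat r}"
proof -
  have cost: "awalk_cost (\<lambda>_. 1) p = real (length p)" for p :: "('a \<times> 'a) list"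
    by (induction p) auto
  show ?thesis
  proof (intro set_eqI iffI)
    fix v assume "v \<in> graph_ball G u r"
    then have "\<mu> (\<lambda>_. 1) u v \<le> ereal (real_of_int r)"
      by (simp add: graph_ball_def graph_dist_def)
    \<comment> \<open>The distance is an infimum over walks. The strict bound by
      \<open>r + 1\<close> produces a walk below it, and integrality of its length brings the bound
      back to \<open>r\<close>.\<close>
    then have "\<mu> (\<lambda>_. 1) u v < ereal (real_of_int (r + 1))"
      by (rule le_less_trans) simp
    then obtain p where p: "awalk u p v" "real (length p) < real_of_int (r + 1)"
      unfolding \<mu>_def by (auto simp: INF_less_iff cost)
    then have "length p \<le> nat r" by linarith
    with p show "v \<in> {v. \<exists>p. awalk u p v \<and> length p \<le> nat r}" by blast
  next
    fix v assume "v \<in> {v. \<exists>p. awalk u p v \<and> length p \<le> nat r}"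
    then obtain p where p: "awalk u p v" "length p \<le> nat r" by blast
    have "\<mu> (\<lambda>_. 1) u v \<le> ereal (real (length p))"
      using min_cost_le_walk_cost[OF p(1), of "\<lambda>_. 1"] by (simp add: cost)
    also have "\<dots> \<le> ereal (real_of_int r)"
      using p(2) assms by simp
    finally show "v \<in> graph_ball G u r"
      using awalk_last_in_verts[OF p(1)] by (simp add: graph_ball_def graph_dist_def)
  qed
qed

text \<open>Local finiteness ensures that spheres and balls in the tree are finite, so that their
  \<open>card\<close> is not the default value 0.\<close>

lemma (in pair_wf_digraph) finite_walk_ends:
  assumes "\<And>v. v \<in> pverts G \<Longrightarrow> finite {w. (v, w) \<in> parcs G}"
  shows "finite {v. \<exists>p. awalk u p v \<and> length p = m}"
proof (induction m arbitrary: u)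
  case 0
  have "{v. \<exists>p. awalk u p v \<and> length p = 0} \<subseteq> {u}"
    by (auto simp: awalk_Nil_iff)
  then show ?case by (rule finite_subset) simp
next
  case (Suc m)
  show ?case
  proof (cases "u \<in> pverts G")
    case True
    have "{v. \<exists>p. awalk u p v \<and> length p = Suc m} \<subseteq>
        (\<Union>w\<in>{w. (u, w) \<in> parcs G}. {v. \<exists>p. awalk w p v \<and> length p = m})"
      by (auto simp: length_Suc_conv awalk_Cons_iff) (metis fst_conv snd_conv)
    then show ?thesis
      by (rule finite_subset) (intro finite_UN_I assms True Suc)
  next
    case False
    then have "{v. \<exists>p. awalk u p v \<and> length p = Suc m} = {}"
      by (auto dest: awalk_hd_in_verts)
    then show ?thesis by (simp only: finite.emptyI)
  qed
qed

section \<open>Growth of trees\<close>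

definition (in pair_wf_digraph) sphere :: "'a \<Rightarrow> nat \<Rightarrow> 'a set" where
  "sphere u m = {v. (\<exists>p. awalk u p v \<and> length p = m) \<and> (\<forall>p. awalk u p v \<longrightarrow> m \<le> length p)}"

text \<open>Shortening the walk to a path adds no vertices, so the path still misses
  \<open>v\<close> and closes up through \<open>v\<close> to a cycle. As \<open>w\<close> and
  \<open>w'\<close> differ, the path has at least one arc, which rules out a mere back-and-forth of
  length two.\<close>

lemma (in pair_bidirected_digraph) cycle_of_avoiding_walk:
  assumes "(v, w) \<in> parcs G" "(v, w') \<in> parcs G" "w \<noteq> w'"
    and "awalk w p w'" "v \<notin> set (pawalk_verts w p)"
  shows "\<exists>c. cycle c \<and> length c \<ge> 3"
proof -
  define q where "q = awalk_to_apath p"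
  have q: "apath w q w'"
    unfolding q_def by (rule apath_awalk_to_apath) fact
  have "set q \<subseteq> set p"
    unfolding q_def by (rule awalk_to_apath_subset) fact
  then have "set (pawalk_verts w q) \<subseteq> set (pawalk_verts w p)"
    using set_awalk_verts[OF assms(4)] set_awalk_verts[OF awalkI_apath[OF q]] by auto
  then have v: "v \<notin> set (pawalk_verts w q)"
    using assms(5) by blast
  have "q \<noteq> []"
    using q assms(3) by (auto simp: apath_Nil_iff)
  let ?c = "(v, w) # q @ [(w', v)]"
  have wq: "awalk w q w'"
    using q by (rule awalkI_apath)
  have w': "awalk w' [(w', v)] v"
    using arcs_symmetric[OF assms(2)] by (auto simp: awalk_simps dest: in_arcsD2)
  have wqv: "awalk w (q @ [(w', v)]) v"
    using wq w' by (rule awalk_appendI)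
  have "awalk v ?c v"
    unfolding awalk_Cons_iff using wqv assms(1) by (simp del: awalk_append_iff)
  moreover have "distinct (tl (pawalk_verts v ?c))"
    using q v wq by (simp add: awalk_verts_append[OF wqv] apath_def)
  ultimately have "cycle ?c"
    unfolding cycle_def by blast
  moreover have "length ?c \<ge> 3"
    using \<open>q \<noteq> []\<close> by (cases q) auto
  ultimately show ?thesis by blast
qed

text \<open>A walk of length at most \<open>m\<close> from \<open>u\<close> to a neighbour of
  \<open>v\<close> cannot meet \<open>v\<close>: reaching \<open>v\<close> already takes
  \<open>m\<close> arcs, and nothing is left for the last arc. Two such walks, joined at
  \<open>u\<close>, therefore avoid \<open>v\<close> and would yield a cycle.\<close>

lemma (in pair_bidirected_digraph) unique_neighbour_not_further:
  assumes acyclic: "\<not> (\<exists>c. cycle c \<and> length c \<ge> 3)"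
    and v: "v \<in> sphere u m"
    and "(v, w) \<in> parcs G" "awalk u p w" "length p \<le> m"
    and "(v, w') \<in> parcs G" "awalk u p' w'" "length p' \<le> m"
  shows "w = w'"
proof (rule ccontr)
  assume "w \<noteq> w'"
  have avoid: "v \<notin> set (pawalk_verts u p)"
    if vw: "(v, w) \<in> parcs G" and p: "awalk u p w" "length p \<le> m" for w p
  proof
    assume "v \<in> set (pawalk_verts u p)"
    then obtain q s where qs: "p = q @ s" "awalk u q v" "awalk v s w"
      using awalk_decomp[OF p(1)] by blast
    then have "m \<le> length q"
      using v by (auto simp: sphere_def)
    with qs(1) p(2) have "s = []"
      by (metis add_le_same_cancel1 le_trans le_zero_eq length_0_conv length_append)
    with qs(3) have "v = w" by (simp add: awalk_Nil_iff)
    with vw show False using pair_no_loops by fastforce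
  qed
  let ?q = "rev_path p @ p'"
  have rev: "awalk w (rev_path p) u"
    using assms(4) by simp
  have "awalk w ?q w'"
    using rev assms(7) by (rule awalk_appendI)
  moreover have "v \<notin> set (pawalk_verts w ?q)"
    unfolding set_awalk_verts_append[OF rev assms(7)] awalk_verts_rev_path[OF assms(4)]
    using avoid[OF assms(3-5)] avoid[OF assms(6-8)] by simp
  ultimately show False
    using cycle_of_avoiding_walk[OF assms(3,6) \<open>w \<noteq> w'\<close>] acyclic by blast
qed

lemma (in pair_bidirected_digraph) card_sphere_ge:
  assumes acyclic: "\<not> (\<exists>c. cycle c \<and> length c \<ge> 3)"
    and fin: "\<And>v. v \<in> pverts G \<Longrightarrow> finite {w. (v, w) \<in> parcs G}"
    and deg: "\<And>v. v \<in> pverts G \<Longrightarrow> card {w. (v, w) \<in> parcs G} \<ge> Suc d"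
    and u: "u \<in> pverts G"
  shows "d ^ m \<le> card (sphere u m)"
proof (induction m)
  case 0
  have "sphere u 0 = {u}"
    using u by (auto simp: sphere_def awalk_Nil_iff)
  then show ?case by simp
next
  case (Suc m)
  let ?N = "\<lambda>v. {w. (v, w) \<in> parcs G}"
  let ?C = "\<lambda>v. ?N v \<inter> sphere u (Suc m)"
  have fin_sphere: "finite (sphere u j)" for j
    by (rule finite_subset[OF _ finite_walk_ends[OF fin, of u j]]) (auto simp: sphere_def)
  have vert: "v \<in> pverts G" if "v \<in> sphere u j" for v j
    using that by (auto simp: sphere_def dest: awalk_last_in_verts)
  have children: "d \<le> card (?C v)" if v: "v \<in> sphere u m" for v
  proof -
    \<comment> \<open>Every neighbour of \<open>v\<close> is the end of a walk of length
      \<open>Suc m\<close> through \<open>v\<close>. It can miss the next sphere only because of a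
      shorter walk, so it is no further from \<open>u\<close> than \<open>v\<close> is, and there is
      at most one such neighbour.\<close>
    let ?P = "?N v - sphere u (Suc m)"
    have earlier: "\<exists>p. awalk u p w \<and> length p \<le> m" if w: "w \<in> ?P" for w
    proof -
      obtain p where p: "awalk u p v" "length p = m"
        using v by (auto simp: sphere_def)
      have "awalk v [(v, w)] w"
        using w by (auto simp: awalk_simps dest: in_arcsD2)
      then have "awalk u (p @ [(v, w)]) w"
        using p(1) awalk_appendI by blast
      then have "\<exists>p. awalk u p w \<and> length p = Suc m"
        using p(2) by (intro exI[of _ "p @ [(v, w)]"]) simp
      with w show ?thesis
        by (auto simp: sphere_def not_less_eq_eq)
    qed
    have "card ?P \<le> 1"
    proof (rule card_le_Suc0_iff_eq[THEN iffD2, unfolded One_nat_def[symmetric]])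
      show "finite ?P"
        using fin[OF vert[OF v]] by blast
      show "\<forall>w\<in>?P. \<forall>w'\<in>?P. w = w'"
        using earlier unique_neighbour_not_further[OF acyclic v] by (metis DiffD1 mem_Collect_eq)
    qed
    moreover have "card (?N v) = card (?C v) + card ?P"
      using fin[OF vert[OF v]] by (metis card_Int_Diff)
    ultimately show ?thesis
      using deg[OF vert[OF v]] by linarith
  qed
  \<comment> \<open>The same uniqueness one level up: a common child lies in the sphere of radius
    \<open>Suc m\<close>, and both \<open>v\<close> and \<open>v'\<close> would be neighbours of it
    that are not further from \<open>u\<close>.\<close>
  have parent: "?C v \<inter> ?C v' = {}" if vv': "v \<in> sphere u m" "v' \<in> sphere u m" "v \<noteq> v'" for v v'
  proof (rule ccontr)
    assume "?C v \<inter> ?C v' \<noteq> {}"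
    then obtain w where w: "w \<in> sphere u (Suc m)" "(w, v) \<in> parcs G" "(w, v') \<in> parcs G"
      using arcs_symmetric by blast
    obtain p where p: "awalk u p v" "length p = m"
      using vv'(1) unfolding sphere_def by blast
    obtain p' where p': "awalk u p' v'" "length p' = m"
      using vv'(2) unfolding sphere_def by blast
    have "v = v'"
      by (rule unique_neighbour_not_further[OF acyclic w(1,2) p(1) _ w(3) p'(1)]) (simp_all add: p p')
    with vv'(3) show False ..
  qed
  have "d ^ Suc m \<le> card (sphere u m) * d"
    using Suc by simp
  also have "\<dots> \<le> (\<Sum>v\<in>sphere u m. card (?C v))"
    using children sum_bounded_below[of "sphere u m" d "\<lambda>v. card (?C v)"] by simp
  also have "\<dots> = card (\<Union>v\<in>sphere u m. ?C v)"
    using fin_sphere parent by (intro card_UN_disjoint[symmetric]) auto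
  also have "\<dots> \<le> card (sphere u (Suc m))"
    by (rule card_mono[OF fin_sphere]) blast
  finally show ?case .
qed

lemma card_graph_ball_regular_tree_ge:
  assumes "undirected_tree T" "regular_graph k T" "t \<in> pverts T" "k \<ge> 1" "r \<ge> 0"
  shows "(k - 1) ^ nat r \<le> card (graph_ball T t r)"
proof -
  interpret pair_bidirected_digraph T
    using assms(1) by (simp add: undirected_tree_def)
  have acyclic: "\<not> (\<exists>c. cycle c \<and> length c \<ge> 3)"
    using assms(1) by (simp add: undirected_tree_def)
  \<comment> \<open>Out-degree counts arcs. Since arcs are pairs, \<open>snd\<close> identifies the
    arcs leaving \<open>v\<close> with its neighbours.\<close>
  have N: "{w. (v, w) \<in> parcs T} = snd ` out_arcs (with_proj T) v" for v
    by (force simp: out_arcs_def)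
  have inj: "inj_on snd (out_arcs (with_proj T) v)" for v
    by (auto simp: inj_on_def out_arcs_def)
  have fin: "finite {w. (v, w) \<in> parcs T}" if "v \<in> pverts T" for v
    using assms(2) that unfolding N by (simp add: regular_graph_def)
  have "card {w. (v, w) \<in> parcs T} = k" if "v \<in> pverts T" for v
    using assms(2) that unfolding N card_image[OF inj] by (simp add: regular_graph_def out_degree_def)
  then have "(k - 1) ^ nat r \<le> card (sphere t (nat r))"
    using card_sphere_ge[OF acyclic fin _ assms(3), of "k - 1"] assms(4) by simp
  also have "\<dots> \<le> card (graph_ball T t r)"
  proof (rule card_mono)
    have "graph_ball T t r = (\<Union>m\<le>nat r. {v. \<exists>p. awalk t p v \<and> length p = m})"
      unfolding graph_ball_eq_walks[OF assms(5)] by auto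
    then show "finite (graph_ball T t r)"
      using finite_walk_ends[OF fin] by simp
    show "sphere t (nat r) \<subseteq> graph_ball T t r"
      unfolding graph_ball_eq_walks[OF assms(5)] by (auto simp: sphere_def)
  qed
  finally show ?thesis .
qed

section \<open>Growth of grids\<close>

text \<open>The squared Euclidean distance is a sum of squares of integers, and an integer is at
  most its square in absolute value.\<close>

lemma grid_arc_l1_dist_le:
  assumes "dist (real_vec x) (real_vec y) = 1"
  shows "(\<Sum>i\<in>UNIV. \<bar>y $ i - x $ i\<bar>) \<le> 1"
proof -
  have "real_of_int (\<Sum>i\<in>UNIV. (y $ i - x $ i)\<^sup>2) = (dist (real_vec x) (real_vec y))\<^sup>2"
    by (simp add: dist_vec_def L2_set_def real_vec_def dist_real_def sum_nonneg power2_commute)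
  then have "(\<Sum>i\<in>UNIV. (y $ i - x $ i)\<^sup>2) = 1"
    unfolding assms power_one by (rule of_int_eq_1_iff[THEN iffD1])
  moreover have "\<bar>a\<bar> \<le> a\<^sup>2" for a :: int
    using self_le_power[of "\<bar>a\<bar>" 2] by (cases "a = 0") simp_all
  ultimately show ?thesis
    using sum_mono[of UNIV "\<lambda>i. \<bar>y $ i - x $ i\<bar>" "\<lambda>i. (y $ i - x $ i)\<^sup>2"] by simp
qed

lemma graph_ball_grid_subset:
  fixes x :: "int ^ 'n"
  assumes "r \<ge> 0"
  shows "graph_ball grid x r \<subseteq> {y. (\<Sum>i\<in>UNIV. \<bar>y $ i - x $ i\<bar>) \<le> r}"
proof -
  interpret pair_bidirected_digraph "grid :: (int ^ 'n) pair_pre_digraph"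
    by (rule pair_bidirected_digraph_grid)
  have arcs: "(x, y) \<in> parcs (grid :: (int ^ 'n) pair_pre_digraph) \<longleftrightarrow> dist (real_vec x) (real_vec y) = 1"
    for x y :: "int ^ 'n"
    by (simp add: grid_def)
  have walk: "(\<Sum>i\<in>UNIV. \<bar>y $ i - x $ i\<bar>) \<le> int (length p)" if "awalk x p y" for x y p
    using that
  proof (induction p arbitrary: x)
    case Nil
    then show ?case by (simp add: awalk_Nil_iff)
  next
    case (Cons e p)
    then have e: "dist (real_vec x) (real_vec (snd e)) = 1" and p: "awalk (snd e) p y"
      unfolding awalk_Cons_iff arcs[symmetric] by auto
    have "(\<Sum>i\<in>UNIV. \<bar>y $ i - x $ i\<bar>)
        \<le> (\<Sum>i\<in>UNIV. \<bar>y $ i - snd e $ i\<bar> + \<bar>snd e $ i - x $ i\<bar>)"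
      by (intro sum_mono) linarith
    also have "\<dots> \<le> int (length p) + 1"
      unfolding sum.distrib by (intro add_mono Cons.IH p grid_arc_l1_dist_le e)
    finally show ?case by simp
  qed
  show ?thesis
  proof
    fix y assume "y \<in> graph_ball grid x r"
    then obtain p where p: "awalk x p y" "length p \<le> nat r"
      unfolding graph_ball_eq_walks[OF assms] by blast
    have "(\<Sum>i\<in>UNIV. \<bar>y $ i - x $ i\<bar>) \<le> r"
      using walk[OF p(1)] p(2) assms by linarith
    then show "y \<in> {y. (\<Sum>i\<in>UNIV. \<bar>y $ i - x $ i\<bar>) \<le> r}" by simp
  qed
qed

lemma sum_power_abs_le:
  fixes z :: real
  assumes "0 \<le> z" "z < 1"
  shows "(\<Sum>j\<in>{- int m..int m}. z ^ nat \<bar>j\<bar>) \<le> (1 + z) / (1 - z)"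
proof -
  \<comment> \<open>The target bound is the sum of the full two-sided geometric series; the term
    with \<open>z ^ Suc m\<close> is the missing tail.\<close>
  have "(\<Sum>j\<in>{- int m..int m}. z ^ nat \<bar>j\<bar>) * (1 - z) = 1 + z - 2 * z ^ Suc m"
  proof (induction m)
    case 0
    then show ?case by simp
  next
    case (Suc m)
    have "{- int (Suc m)..int (Suc m)} = insert (- int (Suc m)) (insert (int (Suc m)) {- int m..int m})"
      by auto
    then have "(\<Sum>j\<in>{- int (Suc m)..int (Suc m)}. z ^ nat \<bar>j\<bar>)
        = 2 * z ^ Suc m + (\<Sum>j\<in>{- int m..int m}. z ^ nat \<bar>j\<bar>)"
      by (simp add: nat_add_distrib)
    then show ?case
      using Suc by (simp only: distrib_right) (simp add: algebra_simps)
  qed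
  then show ?thesis
    using assms by (simp add: pos_le_divide_eq)
qed

text \<open>Each point of \<open>B\<close> has weight at least \<open>z ^ nat r\<close>. Enlarging
  the sum of the weights from \<open>B\<close> to a cube around \<open>x\<close> lets it factor into
  one geometric sum per coordinate.\<close>

lemma card_l1_bounded_le:
  fixes x :: "int ^ 'n" and z :: real
  assumes "0 < z" "z < 1" "r \<ge> 0" and B: "B \<subseteq> {y. (\<Sum>i\<in>UNIV. \<bar>y $ i - x $ i\<bar>) \<le> r}"
  shows "card B * z ^ nat r \<le> ((1 + z) / (1 - z)) ^ CARD('n)"
proof -
  \<comment> \<open>Moves \<open>x\<close> to the origin and turns vectors into functions, the form
    in which a sum over a cube factors.\<close>
  define f where "f = (\<lambda>y i. y $ i - x $ i)"
  define P where "P = (\<Pi>\<^sub>E i\<in>(UNIV :: 'n set). {- int (nat r)..int (nat r)})"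
  have finP: "finite P"
    unfolding P_def by (intro finite_PiE) auto
  have inj: "inj_on f B"
    by (auto simp: inj_on_def f_def fun_eq_iff vec_eq_iff)
  have sub: "f ` B \<subseteq> P"
  proof
    fix g assume "g \<in> f ` B"
    then obtain y where y: "y \<in> B" "g = f y" by blast
    have "\<bar>y $ i - x $ i\<bar> \<le> r" for i
      using y(1) B member_le_sum[of i UNIV "\<lambda>i. \<bar>y $ i - x $ i\<bar>"] by fastforce
    then have "\<bar>g i\<bar> \<le> r" for i
      using y(2) by (simp add: f_def)
    then show "g \<in> P"
      using assms(3) by (auto simp: P_def PiE_UNIV_domain abs_le_iff minus_le_iff)
  qed
  have weight: "z ^ nat r \<le> (\<Prod>i\<in>UNIV. z ^ nat \<bar>g i\<bar>)" if g: "g \<in> f ` B" for g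
  proof -
    have "(\<Sum>i\<in>UNIV. \<bar>g i\<bar>) \<le> r"
      using g B by (auto simp: f_def)
    then have "(\<Sum>i\<in>UNIV. nat \<bar>g i\<bar>) \<le> nat r"
      by (simp add: le_nat_iff assms(3))
    then show ?thesis
      using assms by (simp add: power_decreasing flip: power_sum)
  qed
  have "card B * z ^ nat r = (\<Sum>g\<in>f ` B. z ^ nat r)"
    by (simp add: card_image[OF inj])
  also have "\<dots> \<le> (\<Sum>g\<in>f ` B. \<Prod>i\<in>UNIV. z ^ nat \<bar>g i\<bar>)"
    by (rule sum_mono) (rule weight)
  also have "\<dots> \<le> (\<Sum>g\<in>P. \<Prod>i\<in>UNIV. z ^ nat \<bar>g i\<bar>)"
    using assms by (intro sum_mono2 finP sub prod_nonneg) auto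
  also have "\<dots> = (\<Prod>i\<in>(UNIV :: 'n set). \<Sum>j\<in>{- int (nat r)..int (nat r)}. z ^ nat \<bar>j\<bar>)"
    unfolding P_def by (rule prod_sum_PiE[symmetric]) auto
  also have "\<dots> \<le> (\<Prod>i\<in>(UNIV :: 'n set). (1 + z) / (1 - z))"
    using assms by (intro prod_mono conjI sum_nonneg sum_power_abs_le) auto
  finally show ?thesis
    by simp
qed

lemma card_graph_ball_grid_le:
  fixes x :: "int ^ 'n" and \<alpha> :: real
  assumes "\<alpha> > 0" "r \<ge> 0"
  shows "card (graph_ball grid x r) \<le> exp (r / \<alpha>) * (2 * \<alpha> + 1) ^ CARD('n)"
proof -
  define z where "z = exp (- 1 / \<alpha>)"
  let ?B = "graph_ball grid x r"
  have z: "0 < z" "z < 1"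
    using assms(1) by (auto simp: z_def)
  \<comment> \<open>This says that \<open>z\<close> is at most \<alpha> / (1 + \<alpha>), the point
    where the increasing function (1 + z) / (1 - z) takes the value 2\<alpha> + 1.\<close>
  have "inverse z \<ge> 1 + 1 / \<alpha>"
    using exp_ge_add_one_self[of "1 / \<alpha>"] by (simp add: z_def exp_minus)
  then have "z * (1 + \<alpha>) \<le> \<alpha>"
    using z assms(1) by (simp add: field_simps)
  then have ratio: "(1 + z) / (1 - z) \<le> 2 * \<alpha> + 1"
    using z by (simp add: pos_divide_le_eq algebra_simps)
  have zr: "exp (r / \<alpha>) * z ^ nat r = 1"
    using assms(2) by (simp add: z_def exp_add[symmetric] flip: exp_of_nat_mult)
  have cardB: "card ?B * z ^ nat r \<le> ((1 + z) / (1 - z)) ^ CARD('n)"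
    by (rule card_l1_bounded_le[OF z assms(2) graph_ball_grid_subset[OF assms(2)]])
  have "real (card ?B) = card ?B * (exp (r / \<alpha>) * z ^ nat r)"
    by (simp add: zr)
  also have "\<dots> = exp (r / \<alpha>) * (card ?B * z ^ nat r)"
    by simp
  also have "\<dots> \<le> exp (r / \<alpha>) * ((1 + z) / (1 - z)) ^ CARD('n)"
    using cardB by simp
  also have "\<dots> \<le> exp (r / \<alpha>) * (2 * \<alpha> + 1) ^ CARD('n)"
    using ratio z by (intro mult_left_mono power_mono) auto
  finally show ?thesis .
qed

theorem theorem4:
  fixes k :: nat and \<alpha> :: real and r :: int
    and T :: "'a pair_pre_digraph" and t :: 'a and x :: "int ^ 'n"
  assumes "k \<ge> 3"
    and "CARD('n) \<ge> 2"
    and "\<alpha> > 0"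
    and "(real k - 1) powr \<alpha> > exp 1 * (2 * \<alpha> + 1)"
    and "real_of_int r > \<alpha> * real CARD('n)"
    and "undirected_tree T" and "regular_graph k T" and "t \<in> pverts T"
  shows "card (graph_ball T t r) > card (graph_ball (grid :: (int ^ 'n) pair_pre_digraph) x r)"
proof -
  have "0 \<le> \<alpha> * real CARD('n)"
    using assms(3) by simp
  then have r: "r > 0"
    using assms(5) by linarith
  have n: "real CARD('n) \<le> r / \<alpha>"
    using assms(3,5) by (simp add: field_simps)
  have "real (card (graph_ball (grid :: (int ^ 'n) pair_pre_digraph) x r))
      \<le> exp (r / \<alpha>) * (2 * \<alpha> + 1) ^ CARD('n)"
    using r by (intro card_graph_ball_grid_le assms(3)) simp
  \<comment> \<open>The base exceeds 1, so the exponent \<open>CARD('n)\<close> may grow to r /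
    \<alpha>; then both factors carry the same exponent.\<close>
  also have "\<dots> \<le> exp (r / \<alpha>) * (2 * \<alpha> + 1) powr (r / \<alpha>)"
    using n assms(3) by (simp add: powr_mono flip: powr_realpow)
  also have "\<dots> = (exp 1 * (2 * \<alpha> + 1)) powr (r / \<alpha>)"
    using assms(3) by (simp add: powr_mult exp_powr_real)
  \<comment> \<open>The strict hypothesis on \<alpha> survives because r / \<alpha> is
    positive.\<close>
  also have "\<dots> < ((real k - 1) powr \<alpha>) powr (r / \<alpha>)"
    using assms(3,4) r by (intro powr_less_mono2) auto
  also have "\<dots> = (real k - 1) powr r"
    using assms(3) by (simp add: powr_powr)
  also have "\<dots> = real ((k - 1) ^ nat r)"
    using assms(1) r powr_realpow[of "real k - 1" "nat r"] by simp
  also have "\<dots> \<le> real (card (graph_ball T t r))"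
    using card_graph_ball_regular_tree_ge[OF assms(6-8)] assms(1) r by (simp del: of_nat_power)
  finally show ?thesis by simp
qed

end
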